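(* Let $q$ be a prime power and let $r \geq 1$, $k$ and $d \geq 0$ be integers satisfying $k \geq 2r^2+1$. Suppose $a_1,\ldots,a_k \in \mathbb{F}_q[t]$ are polynomials of degree at most $d$ satisfying $\sum_{i=1}^k a_i = 0$. Then there exist constants $0 < c(r,q) < 1$ (depending only on $r$ and $q$) and $C = C(d,r,q)$ (depending only on $d$, $r$ and $q$) such that for every integer $n \geq 1$, any set $A \subset P_{q,n}$ satisfying $|A| \geq k\,C\,q^{c(r,q)n}$ contains a non-trivial solution to the equation $$\sum_{i=1}^k a_i f_i^r = 0,$$ that is, a tuple $(f_1,\ldots,f_k) \in A^k$ satisfying this equation which is not of the form $(f,\ldots,f)$.
   Context: For a prime power $q$ and integer $n \geq 1$, $P_{q,n}$ denotes the set of polynomials in $\mathbb{F}_q[t]$ of degree strictly less than $n$, so $|P_{q,n}| = q^n$. Since $\sum_i a_i = 0$, every constant tuple $(f,\ldots,f)$ is a solution of the equation; these are called trivial solutions, and all other solutions are non-trivial. *)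

theory Defs
  imports Complex_Main "HOL-Library.Cardinality" "HOL-Computational_Algebra.Polynomial"
begin

text \<open>
  The field with \<open>q\<close> elements is a type \<open>'a\<close> of sort \<open>{field, finite}\<close>, and \<open>q = CARD('a)\<close>.
  The zero polynomial has degree \<open>0\<close> in the library, but degree minus infinity here;
  the disjunct \<open>f = 0\<close> only makes a difference for \<open>n = 0\<close>.
\<close>

definition polys_below :: "nat \<Rightarrow> 'a::{field,finite} poly set" where
  "polys_below n = {f. f = 0 \<or> degree f < n}"

definition is_solution :: "nat \<Rightarrow> nat \<Rightarrow> (nat \<Rightarrow> 'a::{field,finite} poly) \<Rightarrow> (nat \<Rightarrow> 'a poly) \<Rightarrow> bool" where
  "is_solution r k a f \<longleftrightarrow> (\<Sum>i=1..k. a i * f i ^ r) = 0"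

text \<open>A \<open>k\<close>-tuple is a function on \<open>nat\<close> of which only the values on \<open>{1..k}\<close> matter.\<close>

definition trivial_tuple :: "nat \<Rightarrow> (nat \<Rightarrow> 'b) \<Rightarrow> bool" where
  "trivial_tuple k f \<longleftrightarrow> (\<exists>g. \<forall>i\<in>{1..k}. f i = g)"

end

theory Submission
  imports Defs "HOL-Library.FuncSet"
begin

text \<open>
  This is the polynomial method in the style of Croot--Lev--Pach, Ellenberg--Gijswijt and Tao. The
  equation amounts to the vanishing of about \<open>r n + d\<close> coefficients, each of which is a polynomial of
  degree \<open>r\<close> in the \<open>k\<close> blocks of \<open>n\<close> coefficients of \<open>f\<^sub>1, \<dots>, f\<^sub>k\<close>. So its indicator function is a
  polynomial of degree at most \<open>D = (q - 1) r (r n + d)\<close>, and each of its monomials has degree at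
  most \<open>D / k\<close> in some block. As \<open>k > 2 r\<^sup>2\<close>, this is a fixed proportion below the average degree
  \<open>(q - 1) n / 2\<close> of a monomial with exponents below \<open>q\<close>, and there are only \<open>O(q\<^bsup>c n\<^esup>)\<close>
  such monomials with \<open>c < 1\<close>. If \<open>A\<close> has more than twice as many elements, then some weights \<open>w\<^sub>i\<close>
  on \<open>A\<close> are orthogonal to all of them but satisfy \<open>\<Sum>\<^bsub>y\<in>A\<^esub> w\<^sub>1(y) \<cdots> w\<^sub>k(y) \<noteq> 0\<close>. Summing the
  indicator function against the product of the weights gives \<open>0\<close>, so it cannot be diagonal on
  \<open>A\<^sup>k\<close>. This replaces Tao's slice rank lemma.
\<close>

section \<open>Linear algebra: weights orthogonal to few functions\<close>

text \<open>Gaussian elimination: each function of \<open>S\<close> costs at most one pivot,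
  collected in \<open>J\<close>; the rows \<open>u x\<close> are annihilators in reduced form,
  indexed by the free points.\<close>

lemma exists_annihilators:
  fixes S :: "('b \<Rightarrow> 'a::field) set"
  assumes "finite S" "finite A"
  shows "\<exists>J u. J \<subseteq> A \<and> card J \<le> card S \<and>
    (\<forall>x\<in>A-J. u x x = 1 \<and> (\<forall>y\<in>A-J-{x}. u x y = 0) \<and> (\<forall>m\<in>S. (\<Sum>y\<in>A. u x y * m y) = 0))"
  using \<open>finite S\<close>
proof (induction S rule: finite_induct)
  case empty
  show ?case
    by (rule exI[of _ "{}"], rule exI[of _ "\<lambda>x y. if x = y then 1 else 0"]) auto
next
  case (insert m S)
  then obtain J u where J: "J \<subseteq> A" "card J \<le> card S"
    and u: "\<forall>x\<in>A-J. u x x = 1 \<and> (\<forall>y\<in>A-J-{x}. u x y = 0) \<and> (\<forall>m\<in>S. (\<Sum>y\<in>A. u x y * m y) = 0)"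
    by (elim exE conjE)
  have u1: "u x x = 1" if "x \<in> A - J" for x
    using u that by blast
  have u0: "u x y = 0" if "x \<in> A - J" "y \<in> A - J - {x}" for x y
    using u that by blast
  have uS: "(\<Sum>y\<in>A. u x y * m y) = 0" if "x \<in> A - J" "m \<in> S" for x m
    using u that by blast
  define t where "t x = (\<Sum>y\<in>A. u x y * m y)" for x
  show ?case
  proof (cases "\<forall>x\<in>A-J. t x = 0")
    case True
    with J u1 u0 uS show ?thesis
      using insert.hyps by (intro exI[of _ J] exI[of _ u]) (auto simp: t_def)
  next
    case False
    then obtain z where z: "z \<in> A - J" "t z \<noteq> 0" by auto
    \<comment> \<open>Subtracting this multiple of \<open>u z\<close> cancels the pairing with
      \<open>m\<close>; the price is that \<open>z\<close> becomes a pivot.\<close>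
    define v where "v x y = u x y - t x / t z * u z y" for x y
    have vsum: "(\<Sum>y\<in>A. v x y * g y)
        = (\<Sum>y\<in>A. u x y * g y) - t x / t z * (\<Sum>y\<in>A. u z y * g y)" for x g
      by (simp add: v_def algebra_simps sum_subtractf sum_distrib_left)
    have "finite J" using J(1) \<open>finite A\<close> finite_subset by blast
    show ?thesis
    proof (intro exI[of _ "insert z J"] exI[of _ v] conjI ballI)
      show "insert z J \<subseteq> A" using z J by auto
      show "card (insert z J) \<le> card (insert m S)"
        using J(2) z \<open>finite J\<close> insert.hyps by simp
    next
      fix x assume x: "x \<in> A - insert z J"
      then show "v x x = 1" using u1[of x] u0[of z x] z by (auto simp: v_def)
    next
      fix x y assume "x \<in> A - insert z J" "y \<in> A - insert z J - {x}"
      then show "v x y = 0" using u0[of x y] u0[of z y] z by (auto simp: v_def)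
    next
      fix x g assume x: "x \<in> A - insert z J" and g: "g \<in> insert m S"
      show "(\<Sum>y\<in>A. v x y * g y) = 0"
      proof (cases "g = m")
        case True
        then show ?thesis using z vsum[of x m] by (simp add: t_def[symmetric])
      next
        case False
        then have "g \<in> S" using g by auto
        then show ?thesis using uS[of x g] uS[of z g] x z vsum[of x g] by simp
      qed
    qed
  qed
qed

text \<open>
  The function \<open>h\<close> is \<open>1\<close> off a set \<open>J\<close> with at most \<open>card S\<close> elements; \<open>v\<close> vanishes on \<open>J\<close>, and
  \<open>u\<close> agrees off \<open>J\<close> with the indicator of a point at which \<open>v\<close> is \<open>1\<close>.
\<close>
lemma exists_annihilators_sum_prod_nonzero:
  fixes S :: "('b \<Rightarrow> 'a::field) set"
  assumes "finite S" "finite A" "card A > 2 * card S" "k \<ge> 3"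
  shows "\<exists>w :: nat \<Rightarrow> 'b \<Rightarrow> 'a. (\<forall>i. \<forall>m\<in>S. (\<Sum>y\<in>A. w i y * m y) = 0) \<and>
    (\<Sum>y\<in>A. \<Prod>i=1..k. w i y) \<noteq> 0"
proof -
  obtain J u where J: "J \<subseteq> A" "card J \<le> card S"
    and u: "\<forall>x\<in>A-J. u x x = 1 \<and> (\<forall>y\<in>A-J-{x}. u x y = 0) \<and> (\<forall>m\<in>S. (\<Sum>y\<in>A. u x y * m y) = 0)"
    using exists_annihilators[OF assms(1,2)] by (elim exE conjE)
  have u1: "u x x = 1" if "x \<in> A - J" for x
    using u that by blast
  have u0: "u x y = 0" if "x \<in> A - J" "y \<in> A - J - {x}" for x y
    using u that by blast
  have uS: "(\<Sum>y\<in>A. u x y * m y) = 0" if "x \<in> A - J" "m \<in> S" for x m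
    using u that by blast
  define I where "I = A - J"
  have fin: "finite J" "finite I" using J(1) \<open>finite A\<close> finite_subset I_def by auto
  have cI: "card I > card J"
    using assms(3) J card_Diff_subset[OF fin(1) J(1)] by (simp add: I_def)
  \<comment> \<open>Orthogonality of \<open>c\<close> to \<open>T\<close> says that
    \<open>\<Sum>x\<in>I. c x * u x y\<close> vanishes at each \<open>y\<close> in \<open>J\<close>.
    As \<open>J\<close> has fewer elements than \<open>I\<close>, a second elimination yields such a
    \<open>c\<close> with \<open>c z = 1\<close>.\<close>
  define T where "T = (\<lambda>y x. u x y) ` J"
  have "finite T" "card T \<le> card J" using fin(1) card_image_le by (auto simp: T_def)
  obtain K b where K: "K \<subseteq> I" "card K \<le> card T"
    and b: "\<forall>x\<in>I-K. b x x = 1 \<and> (\<forall>y\<in>I-K-{x}. b x y = 0) \<and> (\<forall>m\<in>T. (\<Sum>y\<in>I. b x y * m y) = 0)"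
    using exists_annihilators[OF \<open>finite T\<close> fin(2)] by (elim exE conjE)
  have "card K < card I" using K(2) \<open>card T \<le> card J\<close> cI by simp
  then obtain z where z: "z \<in> I" "z \<notin> K" using K(1) by (metis subset_antisym subsetI less_irrefl)
  define c where "c = b z"
  have cz: "c z = 1" and cT: "\<And>m. m \<in> T \<Longrightarrow> (\<Sum>y\<in>I. c y * m y) = 0"
    using b z by (auto simp: c_def)
  have ann: "(\<Sum>y\<in>A. (\<Sum>x\<in>I. d x * u x y) * m y) = 0" if "m \<in> S" for d :: "'b \<Rightarrow> 'a" and m
  proof -
    have "(\<Sum>y\<in>A. (\<Sum>x\<in>I. d x * u x y) * m y) = (\<Sum>x\<in>I. d x * (\<Sum>y\<in>A. u x y * m y))"
      by (simp add: sum_distrib_left sum_distrib_right mult.assoc) (rule sum.swap)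
    also have "\<dots> = 0" using uS[OF _ that] by (intro sum.neutral) (auto simp: I_def)
    finally show ?thesis .
  qed
  have eval: "(\<Sum>x\<in>I. d x * u x y) = d y" if "y \<in> I" for d :: "'b \<Rightarrow> 'a" and y
  proof -
    have "(\<Sum>x\<in>I. d x * u x y) = (\<Sum>x\<in>I. if x = y then d x else 0)"
      using that u1 u0 by (intro sum.cong) (auto simp: I_def)
    then show ?thesis using that fin(2) by simp
  qed
  define h where "h y = (\<Sum>x\<in>I. 1 * u x y)" for y
  define v where "v y = (\<Sum>x\<in>I. c x * u x y)" for y
  define w where "w i = (if i = 1 then u z else if i = (2::nat) then v else h)" for i
  have vJ: "v y = 0" if "y \<in> J" for y
    using cT[of "\<lambda>x. u x y"] that by (simp add: T_def v_def)
  have split: "(\<Prod>i=1..k. w i y) = u z y * (v y * (\<Prod>i=3..k. h y))" for y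
    using assms(4) by (simp add: prod.atLeast_Suc_atMost w_def numeral_eq_Suc)
  have "(\<Prod>i=1..k. w i y) = (if y = z then 1 else 0)" if "y \<in> A" for y
  proof (cases "y \<in> J")
    case True
    then show ?thesis unfolding split using vJ z by (auto simp: I_def)
  next
    case False
    then have y: "y \<in> I" using that by (simp add: I_def)
    then have "h y = 1" "v y = c y" unfolding h_def v_def using y by (simp_all only: eval)
    then show ?thesis
      unfolding split using u0[of z y] u1[of z] y z cz by (auto simp: I_def)
  qed
  then have "(\<Sum>y\<in>A. \<Prod>i=1..k. w i y) = 1"
    using z \<open>finite A\<close> by (simp add: I_def)
  moreover have "(\<Sum>y\<in>A. w i y * m y) = 0" if "m \<in> S" for i m
    using ann[OF that, of "\<lambda>_. 1"] ann[OF that, of c] uS[of z, OF _ that] z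
    by (auto simp: w_def h_def v_def I_def)
  ultimately show ?thesis by (intro exI[of _ w]) simp
qed

section \<open>Polynomial functions of the coefficients and their degree\<close>

definition coeff_monom :: "nat \<Rightarrow> (nat \<Rightarrow> nat) \<Rightarrow> 'a::comm_semiring_1 poly \<Rightarrow> 'a" where
  "coeff_monom n e f = (\<Prod>j<n. coeff f j ^ e j)"

lemma coeff_monom_mult: "coeff_monom n e f * coeff_monom n e' f = coeff_monom n (\<lambda>j. e j + e' j) f"
  by (simp add: coeff_monom_def power_add prod.distrib)

text \<open>Only values matter, so these are functions rather than formal polynomials;
  \<open>D\<close> bounds the total degree over all \<open>k\<close> blocks. Induction reduces
  statements linear in the function to a single monomial.\<close>

inductive poly_fun :: "nat \<Rightarrow> nat \<Rightarrow> nat \<Rightarrow> ((nat \<Rightarrow> 'a::comm_ring_1 poly) \<Rightarrow> 'a) \<Rightarrow> bool"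
  for k n D where
  monom: "(\<Sum>i=1..k. \<Sum>j<n. e i j) \<le> D \<Longrightarrow>
    poly_fun k n D (\<lambda>f. c * (\<Prod>i=1..k. coeff_monom n (e i) (f i)))"
| add: "poly_fun k n D G \<Longrightarrow> poly_fun k n D H \<Longrightarrow> poly_fun k n D (\<lambda>f. G f + H f)"

lemma poly_fun_const: "poly_fun k n D (\<lambda>f. c)"
  using poly_fun.monom[where k = k and n = n and e = "\<lambda>_ _. 0" and D = D and c = c] by (simp add: coeff_monom_def)

lemma poly_fun_coeff:
  assumes "i \<in> {1..k}" "j < n"
  shows "poly_fun k n 1 (\<lambda>f :: nat \<Rightarrow> 'a::comm_ring_1 poly. coeff (f i) j)"
proof -
  define e where "e i' j' = (if i' = i \<and> j' = j then 1 else 0 :: nat)" for i' j'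
  have "(\<Sum>j'<n. e i' j') = (if i' = i then 1 else 0)" for i'
    using assms(2) by (simp add: e_def)
  then have "(\<Sum>i'=1..k. \<Sum>j'<n. e i' j') \<le> 1" using assms(1) by simp
  moreover have "coeff_monom n (e i') g = (if i' = i then coeff g j else 1)" for i' and g :: "'a poly"
  proof -
    have "coeff_monom n (e i') g
        = (\<Prod>j'<n. if j' = j then (if i' = i then coeff g j else 1) else 1)"
      unfolding coeff_monom_def by (intro prod.cong) (auto simp: e_def)
    then show ?thesis using assms(2) by simp
  qed
  then have "(\<Prod>i'=1..k. coeff_monom n (e i') (f i')) = coeff (f i) j"
    for f :: "nat \<Rightarrow> 'a poly"
    using assms(1) by simp
  ultimately show ?thesis
    using poly_fun.monom[where k = k and n = n and e = e and D = 1 and c = "1 :: 'a"] by simp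
qed

lemma poly_fun_sum:
  assumes "finite X" "\<And>x. x \<in> X \<Longrightarrow> poly_fun k n D (G x)"
  shows "poly_fun k n D (\<lambda>f. \<Sum>x\<in>X. G x f)"
  using assms by (induction X rule: finite_induct) (auto intro: poly_fun_const poly_fun.add)

lemma poly_fun_mult:
  assumes "poly_fun k n D G" "poly_fun k n E H"
  shows "poly_fun k n (D + E) (\<lambda>f. G f * H f)"
  using assms
proof (induction rule: poly_fun.induct)
  case (monom e c)
  from monom(2) show ?case
  proof (induction rule: poly_fun.induct)
    case (monom e' c')
    have "poly_fun k n (D + E) (\<lambda>f. (c * c') * (\<Prod>i=1..k. coeff_monom n (\<lambda>j. e i j + e' i j) (f i)))"
      using monom \<open>(\<Sum>i=1..k. \<Sum>j<n. e i j) \<le> D\<close>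
      by (intro poly_fun.monom) (simp add: sum.distrib)
    then show ?case
      by (simp add: coeff_monom_mult[symmetric] prod.distrib mult_ac)
  qed (auto simp: algebra_simps dest: poly_fun.add)
qed (auto simp: algebra_simps dest: poly_fun.add)

lemma poly_fun_power:
  assumes "poly_fun k n D G"
  shows "poly_fun k n (m * D) (\<lambda>f. G f ^ m)"
  using assms by (induction m) (auto intro: poly_fun_const poly_fun_mult)

lemma poly_fun_prod:
  assumes "\<And>j. j < L \<Longrightarrow> poly_fun k n D (G j)"
  shows "poly_fun k n (L * D) (\<lambda>f. \<Prod>j<L. G j f)"
  using assms
proof (induction L)
  case (Suc L)
  then show ?case
    using poly_fun_mult[of k n "L * D" "\<lambda>f. \<Prod>j<L. G j f" D "G L"] by (simp add: add.commute)
qed (simp add: poly_fun_const)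

lemma poly_fun_coeff_mult:
  assumes "\<And>j. poly_fun k n D (\<lambda>f. coeff (P f) j)" "\<And>j. poly_fun k n E (\<lambda>f. coeff (Q f) j)"
  shows "poly_fun k n (D + E) (\<lambda>f. coeff (P f * Q f) j)"
  unfolding coeff_mult by (intro poly_fun_sum poly_fun_mult assms) auto

lemma poly_fun_coeff_power:
  assumes "\<And>j. poly_fun k n D (\<lambda>f. coeff (P f) j)"
  shows "poly_fun k n (m * D) (\<lambda>f. coeff (P f ^ m) j)"
proof (induction m arbitrary: j)
  case (Suc m)
  then show ?case using poly_fun_coeff_mult[OF assms Suc.IH] by simp
qed (simp add: poly_fun_const)

text \<open>The cutoff makes the coefficients polynomial functions of the first \<open>n\<close> coefficients of each
  \<open>f i\<close> on all tuples, not only on those of small degree.\<close>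
lemma poly_fun_coeff_form:
  fixes a :: "nat \<Rightarrow> 'a::comm_ring_1 poly"
  shows "poly_fun k n r (\<lambda>f. coeff (\<Sum>i=1..k. a i * poly_cutoff n (f i) ^ r) j)"
proof -
  have "poly_fun k n 1 (\<lambda>f. coeff (poly_cutoff n (f i)) j)" if "i \<in> {1..k}" for i j
    using poly_fun_coeff[OF that, of j n] poly_fun_const[of k n 1 0]
    by (cases "j < n") (simp_all add: coeff_poly_cutoff)
  note cutoff = this
  have "poly_fun k n r (\<lambda>f. coeff (poly_cutoff n (f i) ^ r) j)" if i: "i \<in> {1..k}" for i j
    using poly_fun_coeff_power[of k n 1 "\<lambda>f. poly_cutoff n (f i)" r, OF cutoff[OF i]] by simp
  note power = this
  have "poly_fun k n r (\<lambda>f. coeff (a i * poly_cutoff n (f i) ^ r) j)" if i: "i \<in> {1..k}" for i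
    using poly_fun_coeff_mult[of k n 0 "\<lambda>_. a i" r "\<lambda>f. poly_cutoff n (f i) ^ r",
        OF poly_fun_const power[OF i]]
    by simp
  then show ?thesis unfolding coeff_sum by (intro poly_fun_sum) auto
qed

text \<open>By pigeonhole, every monomial of total degree at most \<open>D\<close> has degree at most \<open>D / k\<close> in one
  of its \<open>k\<close> blocks of variables, so the corresponding factor of the sum vanishes.\<close>
lemma poly_fun_weighted_sum_eq_0:
  fixes w :: "nat \<Rightarrow> 'a::comm_ring_1 poly \<Rightarrow> 'a"
  assumes "poly_fun k n D G" "finite A" "k \<ge> 1"
    and w: "\<And>i e. k * (\<Sum>j<n. e j) \<le> D \<Longrightarrow> (\<Sum>y\<in>A. w i y * coeff_monom n e y) = 0"
  shows "(\<Sum>f\<in>PiE {1..k} (\<lambda>_. A). (\<Prod>i=1..k. w i (f i)) * G f) = 0"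
  using assms(1)
proof (induction rule: poly_fun.induct)
  case (monom e c)
  have "\<exists>i\<in>{1..k}. k * (\<Sum>j<n. e i j) \<le> D"
  proof (rule ccontr)
    assume "\<not> ?thesis"
    then have "(\<Sum>i=1..k. D) < (\<Sum>i=1..k. k * (\<Sum>j<n. e i j))"
      using \<open>k \<ge> 1\<close> by (intro sum_strict_mono) (auto simp: not_le)
    also have "\<dots> = k * (\<Sum>i=1..k. \<Sum>j<n. e i j)" by (simp add: sum_distrib_left)
    also have "\<dots> \<le> k * D" using monom by simp
    finally show False by simp
  qed
  then obtain i where i: "i \<in> {1..k}" "(\<Sum>y\<in>A. w i y * coeff_monom n (e i) y) = 0"
    using w by metis
  have "(\<Sum>f\<in>PiE {1..k} (\<lambda>_. A). (\<Prod>i=1..k. w i (f i)) * (c * (\<Prod>i=1..k. coeff_monom n (e i) (f i))))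
      = c * (\<Sum>f\<in>PiE {1..k} (\<lambda>_. A). \<Prod>i=1..k. w i (f i) * coeff_monom n (e i) (f i))"
    by (simp add: sum_distrib_left prod.distrib mult_ac)
  also have "\<dots> = c * (\<Prod>i=1..k. \<Sum>y\<in>A. w i y * coeff_monom n (e i) y)"
    using \<open>finite A\<close> by (subst prod_sum_PiE) auto
  also have "(\<Prod>i=1..k. \<Sum>y\<in>A. w i y * coeff_monom n (e i) y) = 0"
    using i by (intro prod_zero) auto
  also have "c * 0 = 0" by simp
  finally show ?case .
next
  case (add G H)
  then show ?case by (simp add: distrib_left sum.distrib)
qed

section \<open>Fermat's little theorem and the indicator of the solutions\<close>

lemma finite_field_power_card_minus_1:
  fixes x :: "'a::{field,finite}"
  shows "x ^ (CARD('a) - 1) = (if x = 0 then 0 else 1)"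
proof -
  have two: "CARD('a) \<ge> 2" using card_mono[of UNIV "{0::'a, 1}"] by simp
  show ?thesis
  proof (cases "x = 0")
    case False
    \<comment> \<open>Multiplication by \<open>x\<close> permutes the nonzero elements; their
      product is nonzero and cancels.\<close>
    have "(\<Prod>y\<in>UNIV-{0}. y) = (\<Prod>y\<in>UNIV-{0}. x * y)"
      by (rule prod.reindex_bij_witness[of _ "\<lambda>y. x * y" "\<lambda>y. y / x"]) (use False in auto)
    also have "\<dots> = x ^ (CARD('a) - 1) * (\<Prod>y\<in>UNIV-{0}. y)"
      by (simp add: prod.distrib)
    finally show ?thesis using False by simp
  qed (use two in auto)
qed

lemma finite_field_power_reduce:
  "\<exists>m'<CARD('a). m' \<le> m \<and> (\<forall>x::'a::{field,finite}. x ^ m = x ^ m')"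
proof (induction m rule: less_induct)
  case (less m)
  have two: "CARD('a) \<ge> 2" using card_mono[of UNIV "{0::'a, 1}"] by simp
  show ?case
  proof (cases "m < CARD('a)")
    case False
    \<comment> \<open>The exponent drops by \<open>CARD('a) - 1\<close> but stays positive, so that
      both powers vanish at \<open>x = 0\<close>.\<close>
    define m1 where "m1 = m - CARD('a) + 1"
    have m: "m = m1 + (CARD('a) - 1)" "m1 < m" "m1 > 0" using False two by (auto simp: m1_def)
    have "x ^ m = x ^ m1" for x :: 'a
    proof -
      have "x ^ m = x ^ m1 * x ^ (CARD('a) - 1)" by (subst m(1)) (rule power_add)
      then show ?thesis using m(2,3) by (cases "x = 0") (simp_all add: finite_field_power_card_minus_1 power_0_left del: One_nat_def)
    qed
    then show ?thesis using less.IH[OF m(2)] m(2) by (metis le_trans less_imp_le)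
  qed auto
qed

text \<open>Lowering exponents by Fermat never raises the degree, so orthogonality need only be
  imposed on monomials with exponents below \<open>CARD('a)\<close>.\<close>

lemma coeff_monom_reduce:
  "\<exists>e'\<in>PiE {..<n} (\<lambda>_. {..<CARD('a)}). (\<Sum>j<n. e' j) \<le> (\<Sum>j<n. e j) \<and>
    (coeff_monom n e :: 'a::{field,finite} poly \<Rightarrow> 'a) = coeff_monom n e'"
proof -
  have "\<forall>j. \<exists>m'<CARD('a). m' \<le> e j \<and> (\<forall>x::'a. x ^ e j = x ^ m')"
    using finite_field_power_reduce by blast
  then obtain g where g: "\<And>j. g j < CARD('a)" "\<And>j. g j \<le> e j" "\<And>j (x::'a). x ^ e j = x ^ g j"
    by metis
  show ?thesis
    by (rule bexI[of _ "restrict g {..<n}"]) (auto simp: coeff_monom_def fun_eq_iff g intro: sum_mono)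
qed

text \<open>If there were only trivial solutions, then the indicator function of the solutions, which by
  Fermat's little theorem is a product of polynomial functions, would be diagonal on \<open>A\<^sup>k\<close>.\<close>
lemma exists_nontrivial_solution:
  fixes a :: "nat \<Rightarrow> 'a::{field,finite} poly"
  assumes r: "r \<ge> 1" and k: "k \<ge> 3" and n: "n \<ge> 1"
    and a: "\<And>i. i \<in> {1..k} \<Longrightarrow> degree (a i) \<le> d" "(\<Sum>i=1..k. a i) = 0"
    and A: "finite A" "A \<subseteq> polys_below n"
    and card: "card A > 2 * card {e \<in> PiE {..<n} (\<lambda>_. {..<CARD('a)}).
      k * (\<Sum>j<n. e j) \<le> (CARD('a) - 1) * r * (r * n + d)}"
  shows "\<exists>f. (\<forall>i\<in>{1..k}. f i \<in> A) \<and> is_solution r k a f \<and> \<not> trivial_tuple k f"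
proof (rule ccontr)
  assume no: "\<not> ?thesis"
  define D where "D = (CARD('a) - 1) * r * (r * n + d)"
  define M where "M = {e \<in> PiE {..<n} (\<lambda>_. {..<CARD('a)}). k * (\<Sum>j<n. e j) \<le> D}"
  have "finite M" unfolding M_def by (rule finite_subset[of _ "PiE {..<n} (\<lambda>_. {..<CARD('a)})"])
      (auto intro: finite_PiE)
  define S where "S = (coeff_monom n :: _ \<Rightarrow> 'a poly \<Rightarrow> 'a) ` M"
  have "finite S" "2 * card S < card A"
    using \<open>finite M\<close> card_image_le[OF \<open>finite M\<close>, of "coeff_monom n :: _ \<Rightarrow> 'a poly \<Rightarrow> 'a"] card
    by (auto simp: S_def M_def D_def)
  then obtain w :: "nat \<Rightarrow> 'a poly \<Rightarrow> 'a"
    where w: "\<And>i m. m \<in> S \<Longrightarrow> (\<Sum>y\<in>A. w i y * m y) = 0" "(\<Sum>y\<in>A. \<Prod>i=1..k. w i y) \<noteq> 0"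
    using exists_annihilators_sum_prod_nonzero[of S A k] A(1) k by metis
  have w0: "(\<Sum>y\<in>A. w i y * coeff_monom n e y) = 0" if "k * (\<Sum>j<n. e j) \<le> D" for i e
  proof -
    obtain e' where e': "e' \<in> PiE {..<n} (\<lambda>_. {..<CARD('a)})" "(\<Sum>j<n. e' j) \<le> (\<Sum>j<n. e j)"
        "(coeff_monom n e :: 'a poly \<Rightarrow> 'a) = coeff_monom n e'"
      using coeff_monom_reduce by blast
    have "k * (\<Sum>j<n. e' j) \<le> D" using that e'(2) by (meson le_trans mult_le_mono2)
    then show ?thesis using e' w(1) by (auto simp: S_def M_def)
  qed
  define P where "P f = (\<Sum>i=1..k. a i * poly_cutoff n (f i) ^ r)" for f
  \<comment> \<open>With \<open>q = CARD('a)\<close>, \<open>1 - x ^ (q - 1)\<close> is the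
    indicator of \<open>x = 0\<close>. On tuples from \<open>A\<close> the product tests
    \<open>P f = 0\<close>, because there \<open>P f\<close> has degree below
    \<open>r * n + d\<close>.\<close>
  define G where "G f = (\<Prod>j<r * n + d. 1 + (- 1) * coeff (P f) j ^ (CARD('a) - 1))" for f
  have Pc: "poly_fun k n r (\<lambda>f. coeff (P f) j)" for j
    unfolding P_def by (rule poly_fun_coeff_form)
  have "poly_fun k n ((r * n + d) * (0 + (CARD('a) - 1) * r)) G"
    unfolding G_def
    by (intro poly_fun_prod poly_fun.add poly_fun_mult poly_fun_const poly_fun_power Pc)
  then have "poly_fun k n D G" by (simp add: D_def mult_ac)
  then have zero: "(\<Sum>f\<in>PiE {1..k} (\<lambda>_. A). (\<Prod>i=1..k. w i (f i)) * G f) = 0"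
    by (rule poly_fun_weighted_sum_eq_0) (use A(1) k w0 in auto)
  have deg: "degree y < n" if "y \<in> A" for y
    using that A(2) n by (auto simp: polys_below_def)
  have cut: "poly_cutoff n y = y" if "y \<in> A" for y
    using deg[OF that] by (auto simp: poly_eq_iff coeff_poly_cutoff coeff_eq_0)
  have G: "G f = (if is_solution r k a f then 1 else 0)" if f: "\<And>i. i \<in> {1..k} \<Longrightarrow> f i \<in> A" for f
  proof -
    have P: "P f = (\<Sum>i=1..k. a i * f i ^ r)"
      unfolding P_def using f cut by (intro sum.cong) auto
    have "degree (a i * f i ^ r) < r * n + d" if i: "i \<in> {1..k}" for i
    proof -
      have "degree (a i * f i ^ r) \<le> degree (a i) + degree (f i) * r"
        using degree_mult_le degree_power_le by (meson add_left_mono le_trans)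
      also have "\<dots> < d + n * r" using deg[OF f[OF i]] r a(1)[OF i] by (intro add_le_less_mono) auto
      finally show ?thesis by (simp add: ac_simps)
    qed
    then have "degree (P f) < r * n + d"
      unfolding P using k r n by (intro degree_sum_less) auto
    then have "P f = 0 \<longleftrightarrow> (\<forall>j<r * n + d. coeff (P f) j = 0)"
      by (metis coeff_0 leading_coeff_0_iff)
    moreover have "G f = (if \<forall>j<r * n + d. coeff (P f) j = 0 then 1 else 0)"
      unfolding G_def finite_field_power_card_minus_1 by (auto intro!: prod_zero)
    ultimately show ?thesis by (simp add: is_solution_def P[symmetric] del: One_nat_def)
  qed
  \<comment> \<open>Constant tuples are made extensional, so that \<open>\<Delta>\<close> embeds
    \<open>A\<close> as the diagonal of the index set in \<open>zero\<close>.\<close>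
  define \<Delta> where "\<Delta> y = restrict (\<lambda>_. y) {1..k}" for y :: "'a poly"
  have inj: "inj_on \<Delta> A"
  proof (rule inj_onI)
    fix x y assume "\<Delta> x = \<Delta> y"
    then have "\<Delta> x 1 = \<Delta> y 1" by simp
    then show "x = y" using k by (simp add: \<Delta>_def)
  qed
  have sol: "is_solution r k a f \<longleftrightarrow> f \<in> \<Delta> ` A" if f: "f \<in> PiE {1..k} (\<lambda>_. A)" for f
  proof
    assume "is_solution r k a f"
    then have "trivial_tuple k f" using no f by (auto simp: PiE_iff)
    then obtain g where g: "\<forall>i\<in>{1..k}. f i = g" by (auto simp: trivial_tuple_def)
    then have "f = \<Delta> g" using f by (auto simp: \<Delta>_def PiE_iff extensional_def)
    moreover have "g \<in> A" using g f k by (auto simp: PiE_iff dest!: bspec[of _ _ 1])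
    ultimately show "f \<in> \<Delta> ` A" by auto
  next
    assume "f \<in> \<Delta> ` A"
    then obtain y where "f = \<Delta> y" by auto
    then show "is_solution r k a f"
      using a(2) by (simp add: is_solution_def \<Delta>_def sum_distrib_right[symmetric])
  qed
  have sub: "\<Delta> ` A \<subseteq> PiE {1..k} (\<lambda>_. A)" by (auto simp: \<Delta>_def)
  \<comment> \<open>\<open>G\<close> picks out the diagonal, so the vanishing sum equals the nonzero
    sum of weight products.\<close>
  have "(\<Sum>f\<in>PiE {1..k} (\<lambda>_. A). (\<Prod>i=1..k. w i (f i)) * G f)
      = (\<Sum>f\<in>PiE {1..k} (\<lambda>_. A). if f \<in> \<Delta> ` A then \<Prod>i=1..k. w i (f i) else 0)"
    using G sol by (intro sum.cong) (simp_all add: PiE_iff)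
  also have "\<dots> = (\<Sum>f\<in>\<Delta> ` A. \<Prod>i=1..k. w i (f i))"
    using sub A(1) by (intro sum.mono_neutral_cong_right) (auto intro: finite_PiE)
  also have "\<dots> = (\<Sum>y\<in>A. \<Prod>i=1..k. w i y)"
    unfolding sum.reindex[OF inj] by (simp add: \<Delta>_def)
  finally show False using zero w(2) by simp
qed

section \<open>Counting exponent vectors of small sum\<close>

text \<open>Chernoff's method: as \<open>x < 1\<close>, each counted vector has weight
  \<open>x powr (\<Sum>j<n. e j - T)\<close> at least 1, where \<open>T\<close> is subtracted once
  from the whole sum; over all vectors the weights factor by coordinates.\<close>

lemma card_exponents_le:
  fixes x T :: real
  assumes "0 < x" "x < 1"
  shows "real (card {e \<in> PiE {..<n} (\<lambda>_. {..<q::nat}). real (\<Sum>j<n. e j) \<le> T})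
    \<le> (\<Sum>i<q. x ^ i) ^ n * x powr (- T)"
proof -
  define E where "E = PiE {..<n} (\<lambda>_. {..<q})"
  have "finite E" by (auto simp: E_def intro: finite_PiE)
  have "real (card {e \<in> E. real (\<Sum>j<n. e j) \<le> T}) = (\<Sum>e | e \<in> E \<and> real (\<Sum>j<n. e j) \<le> T. 1)"
    by simp
  also have "\<dots> \<le> (\<Sum>e | e \<in> E \<and> real (\<Sum>j<n. e j) \<le> T. x powr (real (\<Sum>j<n. e j) - T))"
  proof (rule sum_mono)
    fix e assume "e \<in> {e. e \<in> E \<and> real (\<Sum>j<n. e j) \<le> T}"
    then show "1 \<le> x powr (real (\<Sum>j<n. e j) - T)"
      using assms powr_mono'[of "real (\<Sum>j<n. e j) - T" 0 x] by simp
  qed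
  also have "\<dots> \<le> (\<Sum>e\<in>E. x powr (real (\<Sum>j<n. e j) - T))"
    using \<open>finite E\<close> by (intro sum_mono2) auto
  also have "\<dots> = (\<Sum>e\<in>E. (\<Prod>j<n. x ^ e j)) * x powr (- T)"
    unfolding sum_distrib_right
  proof (rule sum.cong[OF refl])
    fix e
    have "x powr (real (\<Sum>j<n. e j) - T) = x powr real (\<Sum>j<n. e j) * x powr (- T)"
      by (simp only: powr_add[symmetric]) simp
    also have "x powr real (\<Sum>j<n. e j) = (\<Prod>j<n. x ^ e j)"
      using assms by (simp only: powr_realpow power_sum)
    finally show "x powr (real (\<Sum>j<n. e j) - T) = (\<Prod>j<n. x ^ e j) * x powr (- T)" .
  qed
  also have "(\<Sum>e\<in>E. (\<Prod>j<n. x ^ e j)) = (\<Sum>i<q. x ^ i) ^ n"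
    unfolding E_def by (subst prod_sum_PiE[symmetric]) auto
  finally show ?thesis by (simp add: E_def)
qed

text \<open>At \<open>x = 1\<close> the left-hand side equals \<open>q\<close> and has derivative \<open>q (q - 1) (1 / 2 - \<alpha>) > 0\<close>.\<close>
lemma exists_chernoff_parameter:
  fixes \<alpha> :: real and q :: nat
  assumes "\<alpha> < 1 / 2" "q \<ge> 2"
  shows "\<exists>x. 0 < x \<and> x < 1 \<and> (\<Sum>i<q. x ^ i) * x powr (- (\<alpha> * (real q - 1))) < real q"
proof -
  define \<phi> where "\<phi> x = (\<Sum>i<q. x ^ i) * x powr (- (\<alpha> * (real q - 1)))" for x :: real
  have "2 * (\<Sum>i<q. real i) = real q * (real q - 1)"
    by (induction q) (simp_all add: algebra_simps)
  then have gauss: "(\<Sum>i<q. real i) = real q * (real q - 1) / 2"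
    by simp
  have "(\<phi> has_real_derivative
      (\<Sum>i<q. real i) + real q * (- (\<alpha> * (real q - 1)))) (at 1)"
    unfolding \<phi>_def by (auto intro!: derivative_eq_intros simp: algebra_simps)
  moreover have "(\<Sum>i<q. real i) + real q * (- (\<alpha> * (real q - 1)))
      = real q * (real q - 1) * (1 / 2 - \<alpha>)"
    unfolding gauss by (simp add: right_diff_distrib left_diff_distrib)
  moreover have "\<dots> > 0" using assms by (intro mult_pos_pos) auto
  ultimately obtain \<delta> where \<delta>: "\<delta> > 0" "\<And>h. 0 < h \<Longrightarrow> h < \<delta> \<Longrightarrow> \<phi> (1 - h) < \<phi> 1"
    using DERIV_pos_inc_left by (metis (no_types, lifting))
  \<comment> \<open>Capping at \<open>1 / 2\<close> keeps \<open>1 - h\<close> positive.\<close>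
  define h where "h = min (\<delta> / 2) (1 / 2)"
  have "0 < h" "h < \<delta>" "h < 1" using \<delta>(1) by (auto simp: h_def)
  then show ?thesis
    using \<delta>(2)[of h] by (intro exI[of _ "1 - h"]) (simp add: \<phi>_def)
qed

text \<open>The least admissible \<open>k\<close> is the worst case. The parameter \<open>x\<close>,
  and with it \<open>c\<close>, is chosen from \<open>q\<close> and \<open>r\<close> alone;
  \<open>d\<close> shifts the threshold by an amount independent of \<open>n\<close> and so enters
  only \<open>C\<close>.\<close>

lemma card_low_degree_exponents_bound:
  fixes q r :: nat
  assumes "q \<ge> 2"
  shows "\<exists>c::real. 0 < c \<and> c < 1 \<and> (\<forall>d::nat. \<exists>C>0. \<forall>n k. k \<ge> 2 * r\<^sup>2 + 1 \<longrightarrow>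
    real (card {e \<in> PiE {..<n} (\<lambda>_. {..<q}). k * (\<Sum>j<n. e j) \<le> (q - 1) * r * (r * n + d)})
      \<le> C * real q powr (c * real n))"
proof -
  define s where "s = 2 * real r ^ 2 + 1"
  have pos: "s > 0" by (simp add: s_def add_nonneg_pos)
  \<comment> \<open>Apart from the \<open>d\<close> term, the degree bound divided by
    \<open>s\<close> is \<open>\<alpha> * (q - 1) * n\<close>: \<open>\<alpha>\<close> is the
    permitted average exponent as a fraction of \<open>q - 1\<close>.\<close>
  define \<alpha> where "\<alpha> = real r ^ 2 / s"
  have "\<alpha> < 1 / 2" using pos by (simp add: \<alpha>_def field_simps) (simp add: s_def)
  then obtain x where x: "0 < x" "x < 1"
    and lt: "(\<Sum>i<q. x ^ i) * x powr (- (\<alpha> * (real q - 1))) < real q"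
    using exists_chernoff_parameter assms by blast
  define B where "B = (\<Sum>i<q. x ^ i) * x powr (- (\<alpha> * (real q - 1)))"
  have "(\<Sum>i<q. x ^ i) > 0" using x assms by (intro sum_pos) (auto simp: lessThan_empty_iff)
  then have B: "0 < B" "B < real q" using lt x by (auto simp: B_def)
  \<comment> \<open>The maximum keeps \<open>c\<close> positive however small \<open>B\<close> is;
    \<open>B < q\<close> gives \<open>c < 1\<close>.\<close>
  define c where "c = max (1 / 2) (log (real q) B)"
  have c: "0 < c" "c < 1" using B assms by (auto simp: c_def log_less_one_cancel_iff)
  have "B = real q powr log (real q) B" using B assms by simp
  also have "\<dots> \<le> real q powr c" using assms by (intro powr_mono) (auto simp: c_def)
  finally have Bc: "B \<le> real q powr c" .
  have bound: "real (card {e \<in> PiE {..<n} (\<lambda>_. {..<q}). k * (\<Sum>j<n. e j) \<le> (q - 1) * r * (r * n + d)})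
      \<le> x powr (- ((real q - 1) * r * d / s)) * real q powr (c * real n)"
    if k: "k \<ge> 2 * r\<^sup>2 + 1" for d n k
  proof -
    define T0 where "T0 = (real q - 1) * r * d / s"
    define T where "T = \<alpha> * (real q - 1) * real n + T0"
    have T: "s * T = (real q - 1) * r * (r * n + d)"
      using pos by (simp add: T_def T0_def \<alpha>_def field_simps power2_eq_square)
    have xn: "(x powr (- (\<alpha> * (real q - 1)))) ^ n = x powr (- (\<alpha> * (real q - 1)) * real n)"
      using x powr_powr[of x "- (\<alpha> * (real q - 1))" "real n"]
        powr_realpow[of "x powr (- (\<alpha> * (real q - 1)))" n] by simp
    have "real (\<Sum>j<n. e j) \<le> T" if e: "k * (\<Sum>j<n. e j) \<le> (q - 1) * r * (r * n + d)" for e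
    proof -
      have "(2 * r\<^sup>2 + 1) * (\<Sum>j<n. e j) \<le> (q - 1) * r * (r * n + d)"
        using e k by (meson le_trans mult_le_mono1)
      then have "real ((2 * r\<^sup>2 + 1) * (\<Sum>j<n. e j)) \<le> real ((q - 1) * r * (r * n + d))"
        by (simp only: of_nat_le_iff)
      then have "s * real (\<Sum>j<n. e j) \<le> s * T"
        unfolding T unfolding s_def using assms by (simp only: of_nat_mult of_nat_add of_nat_power of_nat_numeral of_nat_1 of_nat_diff)
      then show ?thesis using pos by (simp only: mult_le_cancel_left_pos)
    qed
    then have "real (card {e \<in> PiE {..<n} (\<lambda>_. {..<q}). k * (\<Sum>j<n. e j) \<le> (q - 1) * r * (r * n + d)})
        \<le> real (card {e \<in> PiE {..<n} (\<lambda>_. {..<q}). real (\<Sum>j<n. e j) \<le> T})"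
      by (intro of_nat_mono card_mono)
         (auto intro: finite_subset[of _ "PiE {..<n} (\<lambda>_. {..<q})"] finite_PiE)
    also have "\<dots> \<le> (\<Sum>i<q. x ^ i) ^ n * x powr (- T)" by (rule card_exponents_le[OF x])
    also have "x powr (- T) = (x powr (- (\<alpha> * (real q - 1)))) ^ n * x powr (- T0)"
      by (simp add: xn T_def powr_add[symmetric])
    also have "(\<Sum>i<q. x ^ i) ^ n * ((x powr (- (\<alpha> * (real q - 1)))) ^ n * x powr (- T0))
        = x powr (- T0) * B ^ n"
      by (simp add: B_def power_mult_distrib)
    also have "\<dots> \<le> x powr (- T0) * (real q powr c) ^ n"
      using B Bc by (intro mult_left_mono power_mono) auto
    also have "(real q powr c) ^ n = real q powr (c * real n)"
      using assms by (simp add: powr_powr powr_realpow[symmetric])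
    finally show ?thesis by (simp add: T0_def)
  qed
  show ?thesis
  proof (rule exI[of _ c], intro conjI allI)
    fix d :: nat
    show "\<exists>C>0. \<forall>n k. k \<ge> 2 * r\<^sup>2 + 1 \<longrightarrow>
        real (card {e \<in> PiE {..<n} (\<lambda>_. {..<q}). k * (\<Sum>j<n. e j) \<le> (q - 1) * r * (r * n + d)})
          \<le> C * real q powr (c * real n)"
      using bound[where d = d] x
      by (intro exI[of _ "x powr (- ((real q - 1) * r * d / s))"]) simp
  qed (use c in auto)
qed

section \<open>Choice of the constants and conclusion\<close>

theorem theorem1:
  fixes r :: nat
  assumes "r \<ge> 1"
  shows "\<exists>c::real. 0 < c \<and> c < 1 \<and>
    (\<forall>d::nat. \<exists>C::real.
      \<forall>(k::nat) (a :: nat \<Rightarrow> 'a::{field,finite} poly).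
        k \<ge> 2 * r\<^sup>2 + 1 \<longrightarrow>
        (\<forall>i\<in>{1..k}. degree (a i) \<le> d) \<longrightarrow>
        (\<Sum>i=1..k. a i) = 0 \<longrightarrow>
        (\<forall>(n::nat) (A :: 'a poly set).
          n \<ge> 1 \<longrightarrow>
          A \<subseteq> polys_below n \<longrightarrow>
          real (card A) \<ge> real k * C * real CARD('a) powr (c * real n) \<longrightarrow>
          (\<exists>f :: nat \<Rightarrow> 'a poly. (\<forall>i\<in>{1..k}. f i \<in> A) \<and>
             is_solution r k a f \<and> \<not> trivial_tuple k f)))"
proof -
  have "CARD('a) \<ge> 2" using card_mono[of UNIV "{0::'a, 1}"] by simp
  from card_low_degree_exponents_bound[OF this, of r] obtain c :: real where c: "0 < c" "c < 1"
    and C_ex: "\<And>d::nat. \<exists>C>0. \<forall>n k. k \<ge> 2 * r\<^sup>2 + 1 \<longrightarrow>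
      real (card {e \<in> PiE {..<n} (\<lambda>_. {..<CARD('a)}).
          k * (\<Sum>j<n. e j) \<le> (CARD('a) - 1) * r * (r * n + d)})
        \<le> C * real CARD('a) powr (c * real n)"
    by blast
  show ?thesis
  proof (rule exI[of _ c], intro conjI allI)
    fix d :: nat
    obtain C where C: "C > 0" and bound: "\<And>n k. k \<ge> 2 * r\<^sup>2 + 1 \<Longrightarrow>
        real (card {e \<in> PiE {..<n} (\<lambda>_. {..<CARD('a)}).
            k * (\<Sum>j<n. e j) \<le> (CARD('a) - 1) * r * (r * n + d)})
          \<le> C * real CARD('a) powr (c * real n)"
      using C_ex[of d] by blast
    show "\<exists>C::real. \<forall>(k::nat) (a :: nat \<Rightarrow> 'a poly).
        k \<ge> 2 * r\<^sup>2 + 1 \<longrightarrow>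
        (\<forall>i\<in>{1..k}. degree (a i) \<le> d) \<longrightarrow>
        (\<Sum>i=1..k. a i) = 0 \<longrightarrow>
        (\<forall>(n::nat) (A :: 'a poly set).
          n \<ge> 1 \<longrightarrow>
          A \<subseteq> polys_below n \<longrightarrow>
          real (card A) \<ge> real k * C * real CARD('a) powr (c * real n) \<longrightarrow>
          (\<exists>f :: nat \<Rightarrow> 'a poly. (\<forall>i\<in>{1..k}. f i \<in> A) \<and>
             is_solution r k a f \<and> \<not> trivial_tuple k f))"
    proof (intro exI[of _ C] allI impI)
      fix k n :: nat and a :: "nat \<Rightarrow> 'a poly" and A :: "'a poly set"
      assume k: "k \<ge> 2 * r\<^sup>2 + 1"
        and a: "\<forall>i\<in>{1..k}. degree (a i) \<le> d" "(\<Sum>i=1..k. a i) = 0"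
        and n: "n \<ge> 1" and A: "A \<subseteq> polys_below n"
        and large: "real (card A) \<ge> real k * C * real CARD('a) powr (c * real n)"
      have "r\<^sup>2 \<ge> 1" using assms by simp
      then have k3: "k \<ge> 3" using k by linarith
      define X where "X = C * real CARD('a) powr (c * real n)"
      have "X > 0" using C by (simp add: X_def)
      have XA: "real k * X \<le> real (card A)" using large by (simp add: X_def mult.assoc)
      \<comment> \<open>The factor \<open>k\<close> in the size hypothesis pays for the factor 2
        that the two eliminations require.\<close>
      have "2 * X < real k * X" using k3 \<open>X > 0\<close> by simp
      with XA have XA2: "2 * X < real (card A)" by linarith
      \<comment> \<open>\<open>card\<close> is 0 on infinite sets, so positivity gives
        finiteness.\<close>
      then have "card A > 0" using \<open>X > 0\<close> by linarith
      then have "finite A" by (rule card_ge_0_finite)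
      have "card A > 2 * card {e \<in> PiE {..<n} (\<lambda>_. {..<CARD('a)}).
          k * (\<Sum>j<n. e j) \<le> (CARD('a) - 1) * r * (r * n + d)}"
        using bound[OF k, of n] XA2 unfolding X_def by linarith
      then show "\<exists>f :: nat \<Rightarrow> 'a poly. (\<forall>i\<in>{1..k}. f i \<in> A) \<and>
          is_solution r k a f \<and> \<not> trivial_tuple k f"
        using exists_nontrivial_solution[OF assms k3 n] a \<open>finite A\<close> A by blast
    qed
  qed (use c in auto)
qed

end
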